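(* For $n\ge 1$ let $N=2^n$, let $\pi$ be uniformly distributed on the group $B_{n,s}$ of simple butterfly permutations, and let $h_n^{B}=h(\mathcal T(\pi))$. Then $h_n^{B}$ has the same distribution as $2^{X_n}+2^{n-X_n}-2$, where $X_n\sim \mathrm{Binomial}(n,1/2)$, and $$\frac{\log_2 h_n^{B}-n/2}{\sqrt n/2}$$ converges in distribution to $|Z|$ as $n\to\infty$, where $Z\sim N(0,1)$. In particular, $\mathbb E\,h_n^{B}=2(3/2)^n-2=cN^{\alpha}(1+o(1))$ as $n\to\infty$, with $c=2$ and $\alpha=\log_2(3/2)\approx 0.58496$.
   Context: For a permutation $\pi\in S_k$ written in one-line notation, $\mathcal T(\pi)$ is the binary search tree obtained by inserting the keys $\pi(1),\pi(2),\dots,\pi(k)$ in this order into the initially empty tree (smaller keys go left, larger keys go right). The depth of a node is the number of edges on the path from the root to it, and $h(\mathcal T(\pi))$ is the maximal depth of a node. For $\pi\in S_k$ let $P_\pi$ be the permutation matrix with $P_\pi e_i=e_{\pi(i)}$. For permutations $\rho,\pi$, the permutation $\rho\otimes\pi$ is the one with matrix $P_\rho\otimes P_\pi$ (Kronecker product, i.e. each entry $(P_\rho)_{ij}$ is replaced by the block $(P_\rho)_{ij}P_\pi$). The group of simple butterfly permutations is $B_{n,s}=S_2^{\otimes n}=\{\pi_n\otimes\cdots\otimes\pi_1:\pi_j\in S_2\}\subset S_{2^n}$, which has $2^n$ elements. *)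

theory Defs
  imports
    "HOL-Probability.Probability"
    "HOL-Library.Landau_Symbols"
    "HOL-Library.Tree"
    "Jordan_Normal_Form.Matrix"
begin

section \<open>Binary search trees of permutations\<close>

fun bst_insert :: "'a::linorder \<Rightarrow> 'a tree \<Rightarrow> 'a tree" where
  "bst_insert x Leaf = Node Leaf x Leaf"
| "bst_insert x (Node l y r) =
     (if x < y then Node (bst_insert x l) y r
      else if y < x then Node l y (bst_insert x r)
      else Node l y r)"

text \<open>Keys are inserted from the head of the list to its end.\<close>

definition bst_of_list :: "'a::linorder list \<Rightarrow> 'a tree" where
  "bst_of_list xs = fold bst_insert xs Leaf"

text \<open>\<^const>\<open>Leaf\<close> is the empty tree and not a node, so it contributes no depth.\<close>

fun node_depths :: "'a tree \<Rightarrow> nat set" where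
  "node_depths Leaf = {}"
| "node_depths (Node l x r) = insert 0 (Suc ` (node_depths l \<union> node_depths r))"

text \<open>The height counted in edges; the library's \<^const>\<open>height\<close> counts nodes instead,
  see \<open>max_depth_eq_height\<close> below.\<close>

definition max_depth :: "'a tree \<Rightarrow> nat" where
  "max_depth t = Max (node_depths t)"

lemma finite_node_depths [simp]: "finite (node_depths t)"
  by (induction t) auto

lemma node_depths_eq_empty_iff [simp]: "node_depths t = {} \<longleftrightarrow> t = Leaf"
  by (cases t) auto

lemma Suc_max_depth: "t \<noteq> Leaf \<Longrightarrow> Suc (max_depth t) = height t"
proof (induction t)
  case (Node l x r)
  let ?D = "node_depths l \<union> node_depths r"
  show ?case
  proof (cases "?D = {}")
    case False
    have "max_depth (Node l x r) = Max (Suc ` ?D)"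
      using False by (simp add: max_depth_def)
    also have "\<dots> = Suc (Max ?D)"
      using False by (intro mono_Max_commute [symmetric]) (auto simp: mono_def)
    finally have *: "max_depth (Node l x r) = Suc (Max ?D)" .
    have "Suc (Max ?D) = max (height l) (height r)"
      using Node.IH False
      by (cases "l = Leaf"; cases "r = Leaf") (auto simp: Max_Un max_depth_def simp flip: max_Suc_Suc)
    with * show ?thesis by simp
  qed (auto simp: max_depth_def)
qed auto

lemma max_depth_eq_height: "t \<noteq> Leaf \<Longrightarrow> max_depth t = height t - 1"
  using Suc_max_depth [of t] by simp

text \<open>A permutation in \<open>S\<^sub>k\<close> is a function that permutes \<open>{1..k}\<close>.\<close>

definition perm_bst :: "nat \<Rightarrow> (nat \<Rightarrow> nat) \<Rightarrow> nat tree" where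
  "perm_bst k p = bst_of_list (map p [1..<Suc k])"

definition perm_height :: "nat \<Rightarrow> (nat \<Rightarrow> nat) \<Rightarrow> nat" where
  "perm_height k p = max_depth (perm_bst k p)"

section \<open>Kronecker products and simple butterfly permutations\<close>

text \<open>Matrix indices start at 0 and permutations act on \<open>{1..k}\<close>, hence the shifts.
  Column \<open>c\<close> is the unit vector with its entry 1 in row \<open>p c\<close>.\<close>

definition perm_mat :: "nat \<Rightarrow> (nat \<Rightarrow> nat) \<Rightarrow> int mat" where
  "perm_mat k p = Matrix.mat k k (\<lambda>(r, c). if r + 1 = p (c + 1) then 1 else 0)"

definition kronecker :: "'a::times mat \<Rightarrow> 'a mat \<Rightarrow> 'a mat" where
  "kronecker A B =
     Matrix.mat (dim_row A * dim_row B) (dim_col A * dim_col B)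
       (\<lambda>(i, j). A $$ (i div dim_row B, j div dim_col B) * B $$ (i mod dim_row B, j mod dim_col B))"

text \<open>For \<open>\<rho> \<in> S\<^sub>k\<close> and \<open>\<pi> \<in> S\<^sub>m\<close>; existence and uniqueness are shown in \<open>perm_kron_ex1\<close>.\<close>

definition perm_kron :: "nat \<Rightarrow> nat \<Rightarrow> (nat \<Rightarrow> nat) \<Rightarrow> (nat \<Rightarrow> nat) \<Rightarrow> nat \<Rightarrow> nat" where
  "perm_kron k m \<rho> \<pi> =
     (THE \<sigma>. \<sigma> permutes {1..k * m} \<and>
        perm_mat (k * m) \<sigma> = kronecker (perm_mat k \<rho>) (perm_mat m \<pi>))"

lemma perm_mat_inj:
  assumes "\<sigma> permutes {1..k}" "\<tau> permutes {1..k}" "perm_mat k \<sigma> = perm_mat k \<tau>"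
  shows "\<sigma> = \<tau>"
proof
  fix x
  show "\<sigma> x = \<tau> x"
  proof (cases "x \<in> {1..k}")
    case True
    then obtain c where c: "x = c + 1" "c < k" by (cases x) auto
    have "\<sigma> x \<in> {1..k}"
      using True permutes_in_image [OF assms(1)] by blast
    then obtain r where r: "\<sigma> x = r + 1" "r < k" by (cases "\<sigma> x") auto
    have "perm_mat k \<sigma> $$ (r, c) = 1"
      using c r by (simp add: perm_mat_def)
    then have "perm_mat k \<tau> $$ (r, c) = 1"
      using assms(3) by simp
    then show ?thesis
      using c r by (simp add: perm_mat_def split: if_splits)
  next
    case False
    then show ?thesis
      using assms(1,2) by (metis permutes_not_in)
  qed
qed

lemma perm_kron_ex1:
  assumes \<rho>: "\<rho> permutes {1..k}" and \<pi>: "\<pi> permutes {1..m}"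
  shows "\<exists>!\<sigma>. \<sigma> permutes {1..k * m} \<and>
           perm_mat (k * m) \<sigma> = kronecker (perm_mat k \<rho>) (perm_mat m \<pi>)"
proof -
  define \<sigma> where "\<sigma> i = (if i \<in> {1..k * m}
      then (\<rho> ((i - 1) div m + 1) - 1) * m + \<pi> ((i - 1) mod m + 1) else i)" for i
  have iff: "r + 1 = \<sigma> (c + 1) \<longleftrightarrow>
      r div m + 1 = \<rho> (c div m + 1) \<and> r mod m + 1 = \<pi> (c mod m + 1)"
    and \<sigma>_in: "\<sigma> (c + 1) \<in> {1..k * m}"
    if rc: "c < k * m" for r c
  proof -
    have m: "m > 0" using rc by (cases m) auto
    have "c div m < k" using rc by (simp add: less_mult_imp_div_less)
    then have "\<rho> (c div m + 1) \<in> {1..k}"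
      using permutes_in_image [OF \<rho>, of "c div m + 1"] by simp
    then obtain a where a: "\<rho> (c div m + 1) = a + 1" "a < k"
      by (cases "\<rho> (c div m + 1)") auto
    have "\<pi> (c mod m + 1) \<in> {1..m}"
      using permutes_in_image [OF \<pi>, of "c mod m + 1"] m by (simp add: Suc_leI)
    then obtain b where b: "\<pi> (c mod m + 1) = b + 1" "b < m"
      by (cases "\<pi> (c mod m + 1)") auto
    have \<sigma>: "\<sigma> (c + 1) = a * m + b + 1"
      using rc a b by (simp add: \<sigma>_def)
    have "r = a * m + b \<longleftrightarrow> r div m = a \<and> r mod m = b"
      using b by (auto simp: algebra_simps)
    then show "r + 1 = \<sigma> (c + 1) \<longleftrightarrow>
        r div m + 1 = \<rho> (c div m + 1) \<and> r mod m + 1 = \<pi> (c mod m + 1)"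
      using \<sigma> a b by simp
    have "a * m + b < (a + 1) * m" using b by simp
    also have "\<dots> \<le> k * m" using a by (intro mult_right_mono) auto
    finally show "\<sigma> (c + 1) \<in> {1..k * m}" using \<sigma> by simp
  qed
  have "inj_on \<sigma> {1..k * m}"
  proof (rule inj_onI)
    fix x y assume xy: "x \<in> {1..k * m}" "y \<in> {1..k * m}" "\<sigma> x = \<sigma> y"
    obtain c d where cd: "x = c + 1" "y = d + 1" "c < k * m" "d < k * m"
      using xy by (cases x; cases y) auto
    obtain r where r: "\<sigma> (c + 1) = r + 1"
      using \<sigma>_in [OF cd(3)] by (cases "\<sigma> (c + 1)") auto
    have "\<rho> (c div m + 1) = \<rho> (d div m + 1)" "\<pi> (c mod m + 1) = \<pi> (d mod m + 1)"
      using iff [OF cd(3), of r] iff [OF cd(4), of r] r xy(3) cd by auto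
    then have "c div m = d div m" "c mod m = d mod m"
      using permutes_inj [OF \<rho>] permutes_inj [OF \<pi>] by (auto dest: injD)
    then show "x = y" using cd by (metis div_mult_mod_eq)
  qed
  moreover have "\<sigma> ` {1..k * m} \<subseteq> {1..k * m}"
  proof (rule image_subsetI)
    fix x assume "x \<in> {1..k * m}"
    moreover from this have "x - 1 < k * m" "x - 1 + 1 = x" by auto
    ultimately show "\<sigma> x \<in> {1..k * m}" using \<sigma>_in [of "x - 1"] by metis
  qed
  ultimately have "bij_betw \<sigma> {1..k * m} {1..k * m}"
    by (simp add: bij_betw_def endo_inj_surj)
  then have perm: "\<sigma> permutes {1..k * m}"
    by (rule bij_imp_permutes) (simp only: \<sigma>_def if_False)
  have "perm_mat (k * m) \<sigma> = kronecker (perm_mat k \<rho>) (perm_mat m \<pi>)"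
  proof (rule eq_matI)
    fix r c
    assume "r < dim_row (kronecker (perm_mat k \<rho>) (perm_mat m \<pi>))"
      and "c < dim_col (kronecker (perm_mat k \<rho>) (perm_mat m \<pi>))"
    then have rc: "r < k * m" "c < k * m"
      by (simp_all add: kronecker_def perm_mat_def)
    then have "m > 0" by (cases m) auto
    then show "perm_mat (k * m) \<sigma> $$ (r, c) = kronecker (perm_mat k \<rho>) (perm_mat m \<pi>) $$ (r, c)"
      using rc iff [OF rc(2), of r]
      by (simp add: kronecker_def perm_mat_def less_mult_imp_div_less)
  qed (simp_all add: kronecker_def perm_mat_def)
  with perm perm_mat_inj show ?thesis by metis
qed

text \<open>\<open>kron_chain p n\<close> is \<open>p n \<otimes> \<dots> \<otimes> p 1 \<in> S\<^bsub>2^n\<^esub>\<close>; the empty product is the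
  identity of \<open>S\<^sub>1\<close>.\<close>

fun kron_chain :: "(nat \<Rightarrow> nat \<Rightarrow> nat) \<Rightarrow> nat \<Rightarrow> nat \<Rightarrow> nat" where
  "kron_chain p 0 = id"
| "kron_chain p (Suc n) = perm_kron 2 (2 ^ n) (p (Suc n)) (kron_chain p n)"

definition simple_butterfly :: "nat \<Rightarrow> (nat \<Rightarrow> nat) set" where
  "simple_butterfly n = {kron_chain p n | p. \<forall>j\<in>{1..n}. p j permutes {1..2}}"

lemma kron_chain_permutes:
  "\<forall>j\<in>{1..n}. p j permutes {1..2} \<Longrightarrow> kron_chain p n permutes {1..2 ^ n}"
proof (induction n)
  case 0
  show ?case by (simp only: kron_chain.simps permutes_id)
next
  case (Suc n)
  then have "p (Suc n) permutes {1..2}" "kron_chain p n permutes {1..2 ^ n}" by auto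
  from theI' [OF perm_kron_ex1 [OF this]] show ?case
    by (simp add: perm_kron_def)
qed

lemma finite_simple_butterfly: "finite (simple_butterfly n)"
proof (rule finite_subset)
  show "simple_butterfly n \<subseteq> {\<sigma>. \<sigma> permutes {1..2 ^ n}}"
    using kron_chain_permutes by (auto simp: simple_butterfly_def)
qed (simp add: finite_permutations)

lemma simple_butterfly_nonempty: "simple_butterfly n \<noteq> {}"
proof -
  have "kron_chain (\<lambda>_. id) n \<in> simple_butterfly n"
    unfolding simple_butterfly_def using permutes_id by blast
  then show ?thesis by blast
qed

definition butterfly_pmf :: "nat \<Rightarrow> (nat \<Rightarrow> nat) pmf" where
  "butterfly_pmf n = pmf_of_set (simple_butterfly n)"

end

theory Submission
  imports Defs "HOL-Real_Asymp.Real_Asymp"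
begin

text \<open>The one-line word of \<open>\<rho> \<otimes> \<pi>\<close> with \<open>\<rho> \<in> S\<^sub>2\<close> consists of the word \<open>w\<close> of \<open>\<pi>\<close>
  and a copy of \<open>w\<close> shifted upwards, the copy coming second iff \<open>\<rho>\<close> is the identity. So the tree of
  \<open>\<rho> \<otimes> \<pi>\<close> arises by grafting a copy of the tree of \<open>\<pi>\<close> onto the end of its own right spine
  (or left spine, if \<open>\<rho>\<close> is the swap). This doubles that spine, keeps the
  other one and adds the old length of the doubled spine to the height. Hence spines of \<open>l\<close> and \<open>r\<close> nodes
  always satisfy \<open>l r = 2\<^sup>n\<close> and the height is \<open>l + r - 2\<close> edges, where \<open>l = 2\<^sup>X\<close> and \<open>X\<close> is the
  number of swaps among the \<open>n\<close> independent factors.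

  For the limit law, \<open>log\<^sub>2\<close> of the height differs by at most 1 from
  \<open>max X (n - X) = n/2 + \<bar>X - n/2\<bar>\<close>, so the claim follows from the central limit theorem for
  \<open>X\<close> and the continuity of the absolute value. The characteristic function of the
  standardised \<open>X\<close> is \<open>cos (t / \<surd>n)\<^sup>n\<close>, which tends to \<open>exp (- t\<^sup>2 / 2)\<close>.\<close>

section \<open>Spines and grafting\<close>

text \<open>The count is in nodes, so that grafting adds lengths and doubling a spine multiplies its
  length by 2.\<close>

fun lspine :: "'a tree \<Rightarrow> nat" where
  "lspine Leaf = 0"
| "lspine (Node l x r) = Suc (lspine l)"

fun rspine :: "'a tree \<Rightarrow> nat" where
  "rspine Leaf = 0"
| "rspine (Node l x r) = Suc (rspine r)"

text \<open>The leaf ending the left spine is the place that receives every key smaller than all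
  keys of the tree.\<close>

fun lgraft :: "'a tree \<Rightarrow> 'a tree \<Rightarrow> 'a tree" where
  "lgraft Leaf u = u"
| "lgraft (Node l x r) u = Node (lgraft l u) x r"

fun rgraft :: "'a tree \<Rightarrow> 'a tree \<Rightarrow> 'a tree" where
  "rgraft Leaf u = u"
| "rgraft (Node l x r) u = Node l x (rgraft r u)"

lemma lspine_lgraft [simp]: "lspine (lgraft t u) = lspine t + lspine u"
  by (induction t) auto

lemma rspine_lgraft [simp]: "t \<noteq> Leaf \<Longrightarrow> rspine (lgraft t u) = rspine t"
  by (cases t) auto

lemma height_lgraft [simp]: "height (lgraft t u) = max (height t) (lspine t + height u)"
  by (induction t) auto

lemma rspine_rgraft [simp]: "rspine (rgraft t u) = rspine t + rspine u"
  by (induction t) auto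

lemma lspine_rgraft [simp]: "t \<noteq> Leaf \<Longrightarrow> lspine (rgraft t u) = lspine t"
  by (cases t) auto

lemma height_rgraft [simp]: "height (rgraft t u) = max (height t) (rspine t + height u)"
  by (induction t) auto

lemma lspine_map_tree [simp]: "lspine (map_tree f t) = lspine t"
  by (induction t) auto

lemma rspine_map_tree [simp]: "rspine (map_tree f t) = rspine t"
  by (induction t) auto

text \<open>A key below all keys of \<open>t\<close> turns left at each node of \<open>t\<close> and
  so passes down the left spine into \<open>u\<close>. The grafted tree stays arbitrary because each
  insertion changes it.\<close>

lemma fold_bst_insert_lgraft:
  "\<forall>x\<in>set_tree t. \<forall>y\<in>set ys. y < x \<Longrightarrow>
     fold bst_insert ys (lgraft t u) = lgraft t (fold bst_insert ys u)"
proof (induction ys arbitrary: u)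
  case (Cons y ys)
  have "bst_insert y (lgraft t u) = lgraft t (bst_insert y u)"
    using Cons.prems by (induction t) auto
  with Cons show ?case by simp
qed simp

lemma fold_bst_insert_rgraft:
  "\<forall>x\<in>set_tree t. \<forall>y\<in>set ys. x < y \<Longrightarrow>
     fold bst_insert ys (rgraft t u) = rgraft t (fold bst_insert ys u)"
proof (induction ys arbitrary: u)
  case (Cons y ys)
  have "bst_insert y (rgraft t u) = rgraft t (bst_insert y u)"
    \<comment> \<open>\<open>bst_insert\<close> tests for a smaller key first, so going right
      requires refuting that test.\<close>
    using Cons.prems by (induction t) (auto dest: order.asym)
  with Cons show ?case by simp
qed simp

section \<open>Search trees of concatenated and relabelled words\<close>

lemma lgraft_Leaf [simp]: "lgraft t Leaf = t"
  by (induction t) auto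

lemma rgraft_Leaf [simp]: "rgraft t Leaf = t"
  by (induction t) auto

lemma set_tree_bst_insert [simp]: "set_tree (bst_insert x t) = insert x (set_tree t)"
  by (induction t) auto

lemma set_tree_bst_of_list [simp]: "set_tree (bst_of_list xs) = set xs"
proof -
  have "set_tree (fold bst_insert xs t) = set_tree t \<union> set xs" for t
    by (induction xs arbitrary: t) auto
  then show ?thesis by (simp add: bst_of_list_def)
qed

lemma bst_of_list_eq_Leaf_iff [simp]: "bst_of_list xs = Leaf \<longleftrightarrow> xs = []"
  by (metis eq_set_tree_empty set_empty set_tree_bst_of_list)

lemma bst_of_list_append_less:
  assumes "\<forall>x\<in>set xs. \<forall>y\<in>set ys. y < x"
  shows "bst_of_list (xs @ ys) = lgraft (bst_of_list xs) (bst_of_list ys)"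
  using fold_bst_insert_lgraft [of "bst_of_list xs" ys Leaf] assms
  by (simp add: bst_of_list_def [of "xs @ ys"] flip: bst_of_list_def)

lemma bst_of_list_append_greater:
  assumes "\<forall>x\<in>set xs. \<forall>y\<in>set ys. x < y"
  shows "bst_of_list (xs @ ys) = rgraft (bst_of_list xs) (bst_of_list ys)"
  using fold_bst_insert_rgraft [of "bst_of_list xs" ys Leaf] assms
  by (simp add: bst_of_list_def [of "xs @ ys"] flip: bst_of_list_def)

text \<open>Insertion looks at keys only through comparisons, which \<open>f\<close>
  preserves.\<close>

lemma bst_of_list_map:
  assumes "strict_mono f"
  shows "bst_of_list (map f xs) = map_tree f (bst_of_list xs)"
proof -
  have ins: "bst_insert (f x) (map_tree f t) = map_tree f (bst_insert x t)" for x t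
    by (induction t) (auto simp: strict_mono_less [OF assms])
  have "fold bst_insert (map f xs) (map_tree f t) = map_tree f (fold bst_insert xs t)" for t
    by (induction xs arbitrary: t) (auto simp: ins)
  from this [of Leaf] show ?thesis by (simp add: bst_of_list_def)
qed

section \<open>Trees of simple butterfly permutations\<close>

text \<open>With zero-based images \<open>a\<close> and \<open>b\<close>, the single 1 in column
  \<open>i * m + j\<close> of the Kronecker product stands in row \<open>a * m + b\<close>. Each
  \<open>Suc\<close> passes from matrix indices to permuted points.\<close>

lemma perm_kron_apply:
  assumes \<rho>: "\<rho> permutes {1..k}" and \<pi>: "\<pi> permutes {1..m}" and i: "i < k" and j: "j < m"
  shows "perm_kron k m \<rho> \<pi> (Suc (i * m + j)) = (\<rho> (Suc i) - 1) * m + \<pi> (Suc j)"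
proof -
  define \<sigma> where "\<sigma> = perm_kron k m \<rho> \<pi>"
  have \<sigma>: "\<sigma> permutes {1..k * m}" "perm_mat (k * m) \<sigma> = kronecker (perm_mat k \<rho>) (perm_mat m \<pi>)"
    using theI' [OF perm_kron_ex1 [OF \<rho> \<pi>]] by (auto simp: perm_kron_def \<sigma>_def)
  have "\<rho> (Suc i) \<in> {1..k}" "\<pi> (Suc j) \<in> {1..m}"
    using permutes_in_image [OF \<rho>, of "Suc i"] permutes_in_image [OF \<pi>, of "Suc j"] i j by auto
  then obtain a b where a: "\<rho> (Suc i) = Suc a" "a < k" and b: "\<pi> (Suc j) = Suc b" "b < m"
    by (cases "\<rho> (Suc i)"; cases "\<pi> (Suc j)") auto
  have less: "x * m + y < k * m" if "x < k" "y < m" for x y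
  proof -
    have "x * m + y < (x + 1) * m" using that by simp
    also have "\<dots> \<le> k * m" using that by (intro mult_right_mono) auto
    finally show ?thesis .
  qed
  have "perm_mat (k * m) \<sigma> $$ (a * m + b, i * m + j) = 1"
    unfolding \<sigma>(2) using less [OF a(2) b(2)] less [OF i j] a b i j
    by (simp add: kronecker_def perm_mat_def)
  then have "\<sigma> (Suc (i * m + j)) = Suc (a * m + b)"
    using less [OF a(2) b(2)] less [OF i j] by (simp add: perm_mat_def split: if_splits)
  then show ?thesis using a b by (simp add: \<sigma>_def)
qed

text \<open>Division with remainder by \<open>m\<close> recovers both factors from the values of the
  product. This later turns the uniform law on products into a uniform law on pairs.\<close>

lemma perm_kron_inj:
  assumes \<rho>: "\<rho> permutes {1..k}" "\<rho>' permutes {1..k}"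
    and \<pi>: "\<pi> permutes {1..m}" "\<pi>' permutes {1..m}" and "k > 0" "m > 0"
    and eq: "perm_kron k m \<rho> \<pi> = perm_kron k m \<rho>' \<pi>'"
  shows "\<rho> = \<rho>' \<and> \<pi> = \<pi>'"
proof -
  have *: "\<rho> (Suc i) = \<rho>' (Suc i) \<and> \<pi> (Suc j) = \<pi>' (Suc j)" if "i < k" "j < m" for i j
  proof -
    have "\<rho> (Suc i) \<in> {1..k}" "\<pi> (Suc j) \<in> {1..m}" "\<rho>' (Suc i) \<in> {1..k}" "\<pi>' (Suc j) \<in> {1..m}"
      using permutes_in_image [OF \<rho>(1), of "Suc i"] permutes_in_image [OF \<pi>(1), of "Suc j"]
        permutes_in_image [OF \<rho>(2), of "Suc i"] permutes_in_image [OF \<pi>(2), of "Suc j"] that by auto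
    then obtain a b a' b' where ab: "\<rho> (Suc i) = Suc a" "\<pi> (Suc j) = Suc b" "b < m"
      "\<rho>' (Suc i) = Suc a'" "\<pi>' (Suc j) = Suc b'" "b' < m"
      by (cases "\<rho> (Suc i)"; cases "\<pi> (Suc j)"; cases "\<rho>' (Suc i)"; cases "\<pi>' (Suc j)") auto
    have e: "a * m + b = a' * m + b'"
      using perm_kron_apply [OF \<rho>(1) \<pi>(1) that] perm_kron_apply [OF \<rho>(2) \<pi>(2) that] eq ab by simp
    have "a = a'" using arg_cong [OF e, of "\<lambda>x. x div m"] ab by simp
    with e ab show ?thesis by simp
  qed
  have "\<rho> x = \<rho>' x" for x
  proof (cases "x \<in> {1..k}")
    case True
    then show ?thesis using * [of "x - 1" 0] \<open>m > 0\<close> by auto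
  qed (metis permutes_not_in \<rho>)
  moreover have "\<pi> x = \<pi>' x" for x
  proof (cases "x \<in> {1..m}")
    case True
    then show ?thesis using * [of 0 "x - 1"] \<open>k > 0\<close> by auto
  qed (metis permutes_not_in \<pi>)
  ultimately show ?thesis by auto
qed

section \<open>One-line words and the two elements of \<open>S\<^sub>2\<close>\<close>

definition perm_word :: "nat \<Rightarrow> (nat \<Rightarrow> nat) \<Rightarrow> nat list" where
  "perm_word k p = map p [1..<Suc k]"

lemma set_perm_word: "p permutes {1..k} \<Longrightarrow> set (perm_word k p) = {1..k}"
  by (simp add: perm_word_def permutes_image flip: atLeastLessThanSuc_atLeastAtMost del: upt_Suc)

text \<open>The two halves of the word come from the two block columns; the value of
  \<open>\<rho>\<close> fixes the block row and hence the shift.\<close>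

lemma perm_word_kron:
  assumes "\<rho> permutes {1..2}" "\<pi> permutes {1..m}"
  shows "perm_word (2 * m) (perm_kron 2 m \<rho> \<pi>) =
    map ((+) ((\<rho> 1 - 1) * m)) (perm_word m \<pi>) @ map ((+) ((\<rho> 2 - 1) * m)) (perm_word m \<pi>)"
proof -
  have Suc: "perm_word k p = map (\<lambda>i. p (Suc i)) [0..<k]" for k p
    by (simp add: perm_word_def map_Suc_upt [symmetric] comp_def del: upt_Suc)
  have "[0..<2 * m] = [0..<m] @ map (\<lambda>i. i + m) [0..<m]"
    by (simp add: map_add_upt mult_2 upt_add_eq_append [of 0 m m])
  then show ?thesis
    using perm_kron_apply [OF assms, of 0] perm_kron_apply [OF assms, of 1]
    by (simp add: Suc add.commute eval_nat_numeral)
qed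

text \<open>Indexing by booleans lets a coin toss select the factor; \<open>True\<close> is the
  swap, which lengthens the left spine.\<close>

definition S2 :: "bool \<Rightarrow> nat \<Rightarrow> nat" where
  "S2 b = (if b then Transposition.transpose 1 2 else id)"

lemma S2_apply [simp]: "S2 b (Suc 0) = (if b then 2 else 1)" "S2 b 2 = (if b then 1 else 2)"
  by (auto simp: S2_def)

lemma range_S2: "range S2 = {\<rho>. \<rho> permutes {1..2}}"
proof -
  have "{1..2} = {1, 2::nat}" by auto
  moreover have "range S2 = {id, Transposition.transpose 1 2}"
    by (auto simp: S2_def UNIV_bool)
  ultimately show ?thesis using permutes_doubleton_iff [of _ 1 "2::nat"] by auto
qed

lemma S2_permutes: "S2 b permutes {1..2}"
  using range_S2 by blast

lemma inj_S2: "inj S2"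
proof (rule injI)
  fix a b assume "S2 a = S2 b"
  then have "S2 a 2 = S2 b 2" by simp
  then show "a = b" by (simp split: if_splits)
qed

lemma perm_bst_perm_word: "perm_bst k p = bst_of_list (perm_word k p)"
  by (simp add: perm_bst_def perm_word_def)

lemma perm_bst_not_Leaf: "0 < k \<Longrightarrow> perm_bst k p \<noteq> Leaf"
  by (simp add: perm_bst_def)

text \<open>The word of \<open>\<pi>\<close> has values in \<open>{1..m}\<close>, so all keys of the
  copy shifted by \<open>m\<close> exceed all keys of the unshifted one. The copy read first
  supplies the root.\<close>

lemma perm_bst_kron_S2:
  assumes "\<pi> permutes {1..m}"
  shows "perm_bst (2 * m) (perm_kron 2 m (S2 b) \<pi>) =
    (if b then lgraft (map_tree ((+) m) (perm_bst m \<pi>)) (perm_bst m \<pi>)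
     else rgraft (perm_bst m \<pi>) (map_tree ((+) m) (perm_bst m \<pi>)))"
proof -
  have [simp]: "map ((+) 0) xs = xs" for xs :: "nat list"
    by (induction xs) auto
  have "bst_of_list (map ((+) m) (perm_word m \<pi>) @ perm_word m \<pi>) =
    lgraft (map_tree ((+) m) (perm_bst m \<pi>)) (perm_bst m \<pi>)"
    by (subst bst_of_list_append_less)
      (auto simp: bst_of_list_map strict_mono_def set_perm_word [OF assms] perm_bst_perm_word)
  moreover have "bst_of_list (perm_word m \<pi> @ map ((+) m) (perm_word m \<pi>)) =
    rgraft (perm_bst m \<pi>) (map_tree ((+) m) (perm_bst m \<pi>))"
    by (subst bst_of_list_append_greater)
      (auto simp: bst_of_list_map strict_mono_def set_perm_word [OF assms] perm_bst_perm_word)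
  ultimately show ?thesis
    using perm_word_kron [OF S2_permutes assms, of b] by (simp add: perm_bst_perm_word)
qed

section \<open>Recursive structure of the butterfly group and its uniform law\<close>

lemma simple_butterfly_permutes: "\<pi> \<in> simple_butterfly n \<Longrightarrow> \<pi> permutes {1..2 ^ n}"
  using kron_chain_permutes by (auto simp: simple_butterfly_def simp del: One_nat_def)

lemma simple_butterfly_0: "simple_butterfly 0 = {id}"
  by (auto simp: simple_butterfly_def)

lemma simple_butterfly_Suc:
  "simple_butterfly (Suc n) =
     (\<lambda>(b, \<pi>). perm_kron 2 (2 ^ n) (S2 b) \<pi>) ` (UNIV \<times> simple_butterfly n)"
proof (intro equalityI subsetI)
  fix \<sigma> assume "\<sigma> \<in> simple_butterfly (Suc n)"
  then obtain p where p: "\<sigma> = kron_chain p (Suc n)" "\<forall>j\<in>{1..Suc n}. p j permutes {1..2}"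
    by (auto simp: simple_butterfly_def)
  then have "p (Suc n) \<in> range S2" unfolding range_S2 by auto
  then obtain b where "p (Suc n) = S2 b" by auto
  moreover have "kron_chain p n \<in> simple_butterfly n"
    using p by (auto simp: simple_butterfly_def)
  ultimately show "\<sigma> \<in> (\<lambda>(b, \<pi>). perm_kron 2 (2 ^ n) (S2 b) \<pi>) ` (UNIV \<times> simple_butterfly n)"
    using p by (intro image_eqI [of _ _ "(b, kron_chain p n)"]) auto
next
  fix \<sigma> assume "\<sigma> \<in> (\<lambda>(b, \<pi>). perm_kron 2 (2 ^ n) (S2 b) \<pi>) ` (UNIV \<times> simple_butterfly n)"
  then obtain b p where p: "\<forall>j\<in>{1..n}. p j permutes {1..2}"
    "\<sigma> = perm_kron 2 (2 ^ n) (S2 b) (kron_chain p n)"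
    by (auto simp: simple_butterfly_def)
  \<comment> \<open>The chain of length \<open>n\<close> reads only the factors 1 to
    \<open>n\<close>, so position \<open>Suc n\<close> is free to hold the new factor.\<close>
  define q where "q = p(Suc n := S2 b)"
  have cong: "kron_chain q k = kron_chain p k" if "k \<le> n" for k
    using that by (induction k) (auto simp: q_def)
  have "\<sigma> = kron_chain q (Suc n)"
    using p cong by (simp add: q_def)
  moreover have "\<forall>j\<in>{1..Suc n}. q j permutes {1..2}"
    using p S2_permutes [of b] by (auto simp: q_def)
  ultimately show "\<sigma> \<in> simple_butterfly (Suc n)"
    unfolding simple_butterfly_def by blast
qed

lemma pair_pmf_of_set:
  assumes "finite A" "A \<noteq> {}" "finite B" "B \<noteq> {}"
  shows "pair_pmf (pmf_of_set A) (pmf_of_set B) = pmf_of_set (A \<times> B)"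
proof (rule pmf_eqI)
  fix x
  show "pmf (pair_pmf (pmf_of_set A) (pmf_of_set B)) x = pmf (pmf_of_set (A \<times> B)) x"
    using assms by (cases x) (simp add: pmf_pair card_cartesian_product indicator_def)
qed

text \<open>Since the product map is injective, a uniform element is the product of a fair coin's
  factor and an independent uniform element of the previous group.\<close>

lemma butterfly_pmf_Suc:
  "butterfly_pmf (Suc n) =
     bind_pmf (bernoulli_pmf (1 / 2)) (\<lambda>b. map_pmf (perm_kron 2 (2 ^ n) (S2 b)) (butterfly_pmf n))"
proof -
  let ?f = "\<lambda>(b, \<pi>). perm_kron 2 (2 ^ n) (S2 b) \<pi>"
  have "inj_on ?f (UNIV \<times> simple_butterfly n)"
    \<comment> \<open>\<open>rotated -1\<close> moves the equation between the two products to the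
      front, where destruction matches it.\<close>
    by (auto simp: inj_on_def inj_eq [OF inj_S2] simp del: One_nat_def
        dest!: perm_kron_inj [OF S2_permutes S2_permutes simple_butterfly_permutes
          simple_butterfly_permutes, rotated -1])
  then have "butterfly_pmf (Suc n) = map_pmf ?f (pmf_of_set (UNIV \<times> simple_butterfly n))"
    by (simp add: butterfly_pmf_def simple_butterfly_Suc map_pmf_of_set_inj
        finite_simple_butterfly simple_butterfly_nonempty)
  also have "pmf_of_set (UNIV \<times> simple_butterfly n) = pair_pmf (bernoulli_pmf (1 / 2)) (butterfly_pmf n)"
    by (simp add: bernoulli_pmf_half_conv_pmf_of_set butterfly_pmf_def pair_pmf_of_set
        finite_simple_butterfly simple_butterfly_nonempty)
  finally show ?thesis
    by (simp add: pair_pmf_def map_bind_pmf map_pmf_def bind_assoc_pmf bind_return_pmf)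
qed

section \<open>Laws of the left spine and of the height\<close>

lemma set_butterfly_pmf [simp]: "set_pmf (butterfly_pmf n) = simple_butterfly n"
  by (simp add: butterfly_pmf_def finite_simple_butterfly simple_butterfly_nonempty)

text \<open>Only the swap grafts at the left end. \<open>of_bool b\<close> is the increment of the
  binomial exponent.\<close>

lemma lspine_perm_bst_kron:
  assumes "\<pi> \<in> simple_butterfly n"
  shows "lspine (perm_bst (2 ^ Suc n) (perm_kron 2 (2 ^ n) (S2 b) \<pi>)) =
    2 ^ of_bool b * lspine (perm_bst (2 ^ n) \<pi>)"
  using simple_butterfly_permutes [OF assms]
  by (simp add: perm_bst_kron_S2 perm_bst_not_Leaf)

text \<open>One spine doubles and the other stays, so the product doubles. The height and the sum of
  the spines both grow by the old length of the doubled spine.\<close>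

lemma spines_simple_butterfly:
  assumes "\<pi> \<in> simple_butterfly n"
  shows "lspine (perm_bst (2 ^ n) \<pi>) * rspine (perm_bst (2 ^ n) \<pi>) = 2 ^ n"
    and "height (perm_bst (2 ^ n) \<pi>) + 1 = lspine (perm_bst (2 ^ n) \<pi>) + rspine (perm_bst (2 ^ n) \<pi>)"
proof -
  have "lspine (perm_bst (2 ^ n) \<pi>) * rspine (perm_bst (2 ^ n) \<pi>) = 2 ^ n \<and>
    height (perm_bst (2 ^ n) \<pi>) + 1 = lspine (perm_bst (2 ^ n) \<pi>) + rspine (perm_bst (2 ^ n) \<pi>)"
    using assms
  proof (induction n arbitrary: \<pi>)
    case 0
    then show ?case by (simp add: simple_butterfly_0 perm_bst_def bst_of_list_def)
  next
    case (Suc n)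
    then obtain b \<tau> where \<tau>: "\<tau> \<in> simple_butterfly n" "\<pi> = perm_kron 2 (2 ^ n) (S2 b) \<tau>"
      by (auto simp: simple_butterfly_Suc)
    from Suc.IH [OF \<tau>(1)] have IH: "lspine (perm_bst (2 ^ n) \<tau>) * rspine (perm_bst (2 ^ n) \<tau>) = 2 ^ n"
      "height (perm_bst (2 ^ n) \<tau>) + 1 = lspine (perm_bst (2 ^ n) \<tau>) + rspine (perm_bst (2 ^ n) \<tau>)"
      by auto
    show ?case
      using IH simple_butterfly_permutes [OF \<tau>(1)]
      by (cases b) (simp_all add: \<tau>(2) perm_bst_kron_S2 perm_bst_not_Leaf add_mult_distrib add_mult_distrib2)
  qed
  then show "lspine (perm_bst (2 ^ n) \<pi>) * rspine (perm_bst (2 ^ n) \<pi>) = 2 ^ n"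
    and "height (perm_bst (2 ^ n) \<pi>) + 1 = lspine (perm_bst (2 ^ n) \<pi>) + rspine (perm_bst (2 ^ n) \<pi>)"
    by auto
qed

lemma map_pmf_lspine_butterfly:
  "map_pmf (\<lambda>\<pi>. lspine (perm_bst (2 ^ n) \<pi>)) (butterfly_pmf n) =
   map_pmf (\<lambda>x. 2 ^ x) (binomial_pmf n (1 / 2))"
proof (induction n)
  case 0
  show ?case
    by (simp add: butterfly_pmf_def simple_butterfly_0 perm_bst_def bst_of_list_def pmf_of_set_singleton binomial_pmf_0)
next
  case (Suc n)
  have "map_pmf (\<lambda>\<pi>. lspine (perm_bst (2 ^ Suc n) \<pi>)) (butterfly_pmf (Suc n)) =
    bind_pmf (bernoulli_pmf (1 / 2)) (\<lambda>b.
      map_pmf (\<lambda>\<pi>. 2 ^ of_bool b * lspine (perm_bst (2 ^ n) \<pi>)) (butterfly_pmf n))"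
    unfolding butterfly_pmf_Suc map_bind_pmf pmf.map_comp comp_def
    by (intro bind_pmf_cong map_pmf_cong lspine_perm_bst_kron refl) simp
  also have "\<dots> = bind_pmf (bernoulli_pmf (1 / 2)) (\<lambda>b. map_pmf (\<lambda>l. 2 ^ of_bool b * l)
      (map_pmf (\<lambda>\<pi>. lspine (perm_bst (2 ^ n) \<pi>)) (butterfly_pmf n)))"
    by (simp add: pmf.map_comp comp_def)
  also have "\<dots> = map_pmf (\<lambda>x. 2 ^ x) (binomial_pmf (Suc n) (1 / 2))"
    unfolding Suc.IH
    by (subst binomial_pmf_Suc)
      (auto simp: map_bind_pmf pmf.map_comp comp_def map_pmf_def bind_assoc_pmf bind_return_pmf
        power_add intro!: bind_pmf_cong)
  finally show ?case .
qed

text \<open>By the product invariant the right spine is \<open>2 ^ n\<close> divided by the left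
  one, so the height is a function of the left spine alone and its law suffices.\<close>

lemma map_pmf_height_butterfly:
  "map_pmf (\<lambda>\<pi>. real (perm_height (2 ^ n) \<pi>)) (butterfly_pmf n) =
   map_pmf (\<lambda>x. 2 ^ x + 2 ^ (n - x) - 2) (binomial_pmf n (1 / 2))"
proof -
  have "map_pmf (\<lambda>\<pi>. real (perm_height (2 ^ n) \<pi>)) (butterfly_pmf n) =
    map_pmf (\<lambda>\<pi>. real (lspine (perm_bst (2 ^ n) \<pi>)) + 2 ^ n / real (lspine (perm_bst (2 ^ n) \<pi>)) - 2)
      (butterfly_pmf n)"
  proof (intro map_pmf_cong refl)
    fix \<pi> assume "\<pi> \<in> set_pmf (butterfly_pmf n)"
    then have \<pi>: "\<pi> \<in> simple_butterfly n" by simp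
    let ?l = "lspine (perm_bst (2 ^ n) \<pi>)" and ?r = "rspine (perm_bst (2 ^ n) \<pi>)"
    have "?l * ?r = 2 ^ n" using spines_simple_butterfly [OF \<pi>] by simp
    then have "real ?l * real ?r = 2 ^ n" by (metis of_nat_mult of_nat_numeral of_nat_power)
    \<comment> \<open>The division is legitimate because the product, and hence \<open>?l\<close>,
      is nonzero.\<close>
    then have "real ?r = 2 ^ n / real ?l"
      by (metis mult_zero_left nonzero_mult_div_cancel_left power_not_zero zero_neq_numeral)
    \<comment> \<open>\<open>Suc\<close> converts edges to nodes; \<open>+ 1\<close> belongs to the
      height invariant.\<close>
    moreover have "Suc (perm_height (2 ^ n) \<pi>) + 1 = ?l + ?r"
      using spines_simple_butterfly [OF \<pi>]
      by (simp add: perm_height_def Suc_max_depth perm_bst_not_Leaf)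
    then have "real (perm_height (2 ^ n) \<pi>) = real ?l + real ?r - 2" by linarith
    ultimately show "real (perm_height (2 ^ n) \<pi>) = real ?l + 2 ^ n / real ?l - 2" by simp
  qed
  also have "\<dots> = map_pmf (\<lambda>l. real l + 2 ^ n / real l - 2)
      (map_pmf (\<lambda>\<pi>. lspine (perm_bst (2 ^ n) \<pi>)) (butterfly_pmf n))"
    by (simp add: pmf.map_comp comp_def)
  also have "\<dots> = map_pmf (\<lambda>x. 2 ^ x + 2 ^ (n - x) - 2) (binomial_pmf n (1 / 2))"
    unfolding map_pmf_lspine_butterfly pmf.map_comp comp_def
    by (intro map_pmf_cong refl) (auto simp: power_diff)
  finally show ?thesis .
qed

section \<open>The limit law\<close>

lemma cos_power_limit: "(\<lambda>n. cos (t / sqrt (real n)) ^ n) \<longlonglongrightarrow> exp (- t\<^sup>2 / 2)"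
proof -
  \<comment> \<open>The expansion is computed for a positive parameter; evenness of the cosine
    covers negative \<open>t\<close>, and \<open>t = 0\<close> gives a constant sequence.\<close>
  have pos: "(\<lambda>n. cos (s / sqrt (real n)) ^ n) \<longlonglongrightarrow> exp (- (s * s / 2))" if "s > 0" for s :: real
    using that by real_asymp
  have "(\<lambda>n. cos (\<bar>t\<bar> / sqrt (real n)) ^ n) \<longlonglongrightarrow> exp (- (\<bar>t\<bar> * \<bar>t\<bar> / 2))"
    using pos [of "\<bar>t\<bar>"] by (cases "t = 0") simp_all
  moreover have "cos (\<bar>t\<bar> / sqrt (real n)) = cos (t / sqrt (real n))" for n
    by (cases "t \<ge> 0") auto
  ultimately show ?thesis by (simp add: power2_eq_square)
qed

section \<open>Characteristic functions and the binomial central limit theorem\<close>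

lemma real_distribution_distr_pmf: "real_distribution (distr (measure_pmf p) borel f)"
  by (intro prob_space.real_distribution_distr prob_space_measure_pmf) simp

lemma char_distr_pmf: "char (distr (measure_pmf p) borel f) t = measure_pmf.expectation p (\<lambda>x. iexp (t * f x))"
  by (simp add: char_def integral_distr)

text \<open>This is the binomial theorem. Complex exponentials for \<open>u\<close> and
  \<open>v\<close> give the characteristic function, the values 1 and 2 give the mean
  height.\<close>

lemma expectation_binomial_half_power:
  fixes u v :: "'a :: {banach, second_countable_topology, real_normed_field}"
  shows "measure_pmf.expectation (binomial_pmf n (1 / 2)) (\<lambda>x. u ^ x * v ^ (n - x)) = ((u + v) / 2) ^ n"
proof -
  have "measure_pmf.expectation (binomial_pmf n (1 / 2)) (\<lambda>x. u ^ x * v ^ (n - x)) =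
    (\<Sum>k\<le>n. (real (n choose k) / 2 ^ n) *\<^sub>R (u ^ k * v ^ (n - k)))"
    by (subst expectation_binomial_pmf')
      (auto intro!: sum.cong simp: power_one_over field_simps simp flip: power_add)
  also have "\<dots> = ((u + v) / 2) ^ n"
    by (simp add: binomial_ring power_divide sum_divide_distrib scaleR_conv_of_real mult.assoc)
  finally show ?thesis .
qed

lemma binomial_half_CLT:
  "weak_conv_m
     (\<lambda>n. distr (measure_pmf (binomial_pmf n (1 / 2))) borel
            (\<lambda>x. (real x - real n / 2) / (sqrt (real n) / 2)))
     std_normal_distribution"
proof (rule levy_continuity)
  fix t :: real
  have char: "char (distr (measure_pmf (binomial_pmf n (1 / 2))) borel
      (\<lambda>x. (real x - real n / 2) / (sqrt (real n) / 2))) t = of_real (cos (t / sqrt (real n)) ^ n)" for n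
  proof -
    define s where "s = t / sqrt (real n)"
    have "iexp (t * ((real x - real n / 2) / (sqrt (real n) / 2))) = iexp s ^ x * iexp (- s) ^ (n - x)"
      if "x \<in> set_pmf (binomial_pmf n (1 / 2))" for x
    proof -
      have "x \<le> n" using that by simp
      \<comment> \<open>Writing \<open>2 * x - n\<close> as \<open>x - (n - x)\<close> separates
        successes from failures. For \<open>n = 0\<close> division by zero makes both sides
        0.\<close>
      have "t * ((real x - real n / 2) / (sqrt (real n) / 2)) = real x * s + real (n - x) * (- s)"
        using \<open>x \<le> n\<close> by (cases "n = 0") (simp_all add: s_def of_nat_diff field_simps)
      then have "iexp (t * ((real x - real n / 2) / (sqrt (real n) / 2))) =
          exp (of_nat x * (\<i> * s) + of_nat (n - x) * (\<i> * (- s)))"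
        by (simp only:) (simp add: algebra_simps)
      then show ?thesis by (simp only: exp_add exp_of_nat_mult of_real_minus)
    qed
    then have "char (distr (measure_pmf (binomial_pmf n (1 / 2))) borel
      (\<lambda>x. (real x - real n / 2) / (sqrt (real n) / 2))) t =
      measure_pmf.expectation (binomial_pmf n (1 / 2)) (\<lambda>x. iexp s ^ x * iexp (- s) ^ (n - x))"
      unfolding char_distr_pmf by (intro integral_cong_AE AE_pmfI) auto
    also have "\<dots> = ((iexp s + iexp (- s)) / 2) ^ n"
      by (rule expectation_binomial_half_power)
    also have "(iexp s + iexp (- s)) / 2 = of_real (cos s)"
      by (simp add: cos_exp_eq cos_of_real [symmetric])
    finally show ?thesis by (simp add: s_def)
  qed
  show "(\<lambda>n. char (distr (measure_pmf (binomial_pmf n (1 / 2))) borel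
      (\<lambda>x. (real x - real n / 2) / (sqrt (real n) / 2))) t) \<longlonglongrightarrow> char std_normal_distribution t"
    unfolding char char_std_normal_distribution by (intro tendsto_of_real cos_power_limit)
qed (auto intro: real_distribution_distr_pmf real_dist_normal_dist)

text \<open>If \<open>a \<ge> 1\<close> is the larger exponent, the height lies between
  \<open>2 ^ (a - 1)\<close> and \<open>2 ^ (a + 1)\<close>.\<close>

lemma log2_height_approx:
  assumes "n \<ge> 1" "x \<le> n"
  shows "\<bar>log 2 (2 ^ x + 2 ^ (n - x) - 2) - (real n / 2 + \<bar>real x - real n / 2\<bar>)\<bar> \<le> 1"
proof -
  have *: "\<bar>log 2 (2 ^ a + 2 ^ b - 2) - real a\<bar> \<le> 1" if "b \<le> a" "a \<ge> 1" for a b :: nat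
  proof -
    obtain c where c: "a = Suc c" using \<open>a \<ge> 1\<close> by (cases a) auto
    have "(1::real) \<le> 2 ^ b" "(2::real) ^ b \<le> 2 ^ a" "(1::real) \<le> 2 ^ c" using that by simp_all
    then have bounds: "2 ^ c \<le> (2::real) ^ a + 2 ^ b - 2" "(2::real) ^ a + 2 ^ b - 2 \<le> 2 ^ Suc a"
      unfolding c power_Suc by linarith+
    have "log 2 (2 ^ c) \<le> log 2 (2 ^ a + 2 ^ b - 2 :: real)"
      "log 2 (2 ^ a + 2 ^ b - 2 :: real) \<le> log 2 (2 ^ Suc a)"
      using bounds \<open>1 \<le> 2 ^ c\<close> by (intro log_mono; linarith)+
    then have "real c \<le> log 2 (2 ^ a + 2 ^ b - 2)" "log 2 (2 ^ a + 2 ^ b - 2) \<le> real (Suc a)"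
      by (simp_all only: log_pow_cancel)
    then show ?thesis using c by auto
  qed
  show ?thesis
  proof (cases "n - x \<le> x")
    case True
    then have "real n / 2 + \<bar>real x - real n / 2\<bar> = real x" using assms by auto
    then show ?thesis using * [of "n - x" x] True assms by auto
  next
    case False
    then have "real n / 2 + \<bar>real x - real n / 2\<bar> = real (n - x)" using assms by auto
    then show ?thesis using * [of x "n - x"] False assms by (auto simp: add.commute)
  qed
qed

text \<open>This estimate takes the place of Slutsky's theorem.\<close>

lemma char_log2_height_approx:
  assumes "n \<ge> 1"
  shows "norm
    (char (distr (measure_pmf (binomial_pmf n (1 / 2))) borel
       (\<lambda>x. (log 2 (2 ^ x + 2 ^ (n - x) - 2) - real n / 2) / (sqrt (real n) / 2))) t
     - measure_pmf.expectation (binomial_pmf n (1 / 2))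
         (\<lambda>x. iexp (t * \<bar>(real x - real n / 2) / (sqrt (real n) / 2)\<bar>))) \<le> 2 * \<bar>t\<bar> / sqrt (real n)"
proof -
  let ?B = "binomial_pmf n (1 / 2)"
  let ?Y = "\<lambda>x. (log 2 (2 ^ x + 2 ^ (n - x) - 2) - real n / 2) / (sqrt (real n) / 2)"
  let ?Z = "\<lambda>x. \<bar>(real x - real n / 2) / (sqrt (real n) / 2)\<bar>"
  have "norm (iexp (t * ?Y x) - iexp (t * ?Z x)) \<le> 2 * \<bar>t\<bar> / sqrt (real n)" if "x \<in> set_pmf ?B" for x
  proof -
    have "x \<le> n" using that by simp
    have Z: "?Z x = \<bar>real x - real n / 2\<bar> / (sqrt (real n) / 2)"
      by (simp only: abs_divide) simp
    have "?Y x - ?Z x = (log 2 (2 ^ x + 2 ^ (n - x) - 2) - (real n / 2 + \<bar>real x - real n / 2\<bar>)) / (sqrt (real n) / 2)"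
      by (simp only: Z diff_divide_distrib [symmetric] diff_diff_eq)
    then have "\<bar>?Y x - ?Z x\<bar> = \<bar>log 2 (2 ^ x + 2 ^ (n - x) - 2) - (real n / 2 + \<bar>real x - real n / 2\<bar>)\<bar> / (sqrt (real n) / 2)"
      by (simp only: abs_divide) simp
    also have "\<dots> \<le> 1 / (sqrt (real n) / 2)"
      using log2_height_approx [OF assms \<open>x \<le> n\<close>] by (intro divide_right_mono) auto
    finally have Y: "\<bar>?Y x - ?Z x\<bar> \<le> 2 / sqrt (real n)" by simp
    \<comment> \<open>Factoring out an exponential of modulus 1 reduces the difference to the form
      \<open>iexp u - 1\<close>, whose norm is at most \<open>\<bar>u\<bar>\<close>.\<close>
    have "norm (iexp (t * ?Y x) - iexp (t * ?Z x)) = norm (iexp (t * ?Z x) * (iexp (t * ?Y x - t * ?Z x) - 1))"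
      by (simp only: of_real_diff right_diff_distrib exp_diff) simp
    also have "\<dots> = norm (iexp (t * ?Y x - t * ?Z x) - 1)"
      by (simp only: norm_mult norm_exp_i_times)
    also have "\<dots> \<le> \<bar>t * ?Y x - t * ?Z x\<bar>"
      using iexp_approx1 [of "t * ?Y x - t * ?Z x" 0] by simp
    also have "\<dots> = \<bar>t\<bar> * \<bar>?Y x - ?Z x\<bar>" by (simp only: right_diff_distrib [symmetric] abs_mult)
    also have "\<dots> \<le> \<bar>t\<bar> * (2 / sqrt (real n))" using Y by (intro mult_left_mono) auto
    also have "\<dots> = 2 * \<bar>t\<bar> / sqrt (real n)" by simp
    finally show ?thesis .
  qed
  then have "norm (measure_pmf.expectation ?B (\<lambda>x. iexp (t * ?Y x) - iexp (t * ?Z x)))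
      \<le> measure_pmf.expectation ?B (\<lambda>_. 2 * \<bar>t\<bar> / sqrt (real n))"
    by (intro order.trans [OF integral_norm_bound] integral_mono_AE AE_pmfI) auto
  then show ?thesis by (simp add: char_distr_pmf)
qed

lemma binomial_log2_height_CLT:
  "weak_conv_m
     (\<lambda>n. distr (measure_pmf (binomial_pmf n (1 / 2))) borel
            (\<lambda>x. (log 2 (2 ^ x + 2 ^ (n - x) - 2) - real n / 2) / (sqrt (real n) / 2)))
     (distr std_normal_distribution borel abs)"
proof (rule levy_continuity)
  interpret normal: real_distribution std_normal_distribution by (rule real_dist_normal_dist)
  show "real_distribution (distr std_normal_distribution borel abs)"
    by (intro normal.real_distribution_distr) simp
  fix t :: real
  let ?c = "\<lambda>n. char (distr (measure_pmf (binomial_pmf n (1 / 2))) borel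
            (\<lambda>x. (log 2 (2 ^ x + 2 ^ (n - x) - 2) - real n / 2) / (sqrt (real n) / 2))) t"
  let ?e = "\<lambda>n. measure_pmf.expectation (binomial_pmf n (1 / 2))
         (\<lambda>x. iexp (t * \<bar>(real x - real n / 2) / (sqrt (real n) / 2)\<bar>))"
  \<comment> \<open>The function \<open>iexp (t * \<bar>x\<bar>)\<close> is continuous and bounded
    by 1, so weak convergence applies to it directly; its normal integral is the characteristic
    function of the absolute value.\<close>
  have "(\<lambda>n. integral\<^sup>L (distr (measure_pmf (binomial_pmf n (1 / 2))) borel
            (\<lambda>x. (real x - real n / 2) / (sqrt (real n) / 2))) (\<lambda>x. iexp (t * \<bar>x\<bar>)))
      \<longlonglongrightarrow> integral\<^sup>L std_normal_distribution (\<lambda>x. iexp (t * \<bar>x\<bar>))"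
    by (rule weak_conv_imp_integral_bdd_continuous_conv [OF real_distribution_distr_pmf
          real_dist_normal_dist binomial_half_CLT, where B = 1])
      (auto intro!: continuous_intros)
  then have "?e \<longlonglongrightarrow> char (distr std_normal_distribution borel abs) t"
    by (simp add: integral_distr char_def)
  moreover have "(\<lambda>n. ?c n - ?e n) \<longlonglongrightarrow> 0"
  proof (rule Lim_null_comparison)
    show "\<forall>\<^sub>F n in sequentially. norm (?c n - ?e n) \<le> 2 * \<bar>t\<bar> / sqrt (real n)"
      using eventually_ge_at_top [of 1] by eventually_elim (rule char_log2_height_approx)
    show "(\<lambda>n. 2 * \<bar>t\<bar> / sqrt (real n)) \<longlonglongrightarrow> 0" by real_asymp
  qed
  ultimately have "(\<lambda>n. (?c n - ?e n) + ?e n) \<longlonglongrightarrow> 0 + char (distr std_normal_distribution borel abs) t"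
    by (intro tendsto_add)
  then show "?c \<longlonglongrightarrow> char (distr std_normal_distribution borel abs) t" by simp
qed (rule real_distribution_distr_pmf)

text \<open>The tolerance is half a unit in the fifth decimal. A bound \<open>p / q\<close> on
  \<open>log 2 3\<close> amounts to comparing the integers \<open>2 ^ p\<close> and
  \<open>3 ^ q\<close>.\<close>

lemma log_2_3_2_bounds: "\<bar>log 2 (3 / 2) - 0.58496\<bar> \<le> (0.000005 :: real)"
proof -
  \<comment> \<open>\<open>1054/665\<close> is a convergent of \<open>log 2 3\<close>, and \<open>1539/971\<close> is its mediant
    with the preceding convergent \<open>485/306\<close>.\<close>
  have "log 2 (2 ^ 1054) \<le> log 2 (3 ^ 665 :: real)"
    by (rule log_mono) simp_all
  moreover have "log 2 (3 ^ 971) \<le> log 2 (2 ^ 1539 :: real)"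
    by (rule log_mono) simp_all
  ultimately have "real 1054 \<le> real 665 * log 2 3" "real 971 * log 2 3 \<le> real 1539"
    by (simp_all only: log_pow_cancel log_nat_power zero_less_numeral)
  moreover have "log 2 (3 / 2 :: real) = log 2 3 - 1"
    by (simp add: log_divide)
  ultimately show ?thesis by (simp add: abs_le_iff)
qed

text \<open>By symmetry of the fair coin, each of the two powers has mean
  \<open>(3 / 2) ^ n\<close>.\<close>

lemma expectation_binomial_height:
  "measure_pmf.expectation (binomial_pmf n (1 / 2)) (\<lambda>x. 2 ^ x + 2 ^ (n - x) - 2) = 2 * (3 / 2) ^ n - (2::real)"
  using expectation_binomial_half_power [of n "2::real" 1] expectation_binomial_half_power [of n "1::real" 2]
  by simp

theorem theorem3:
  fixes h :: "nat \<Rightarrow> (nat \<Rightarrow> nat) \<Rightarrow> real" and \<alpha> :: real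
  defines "h \<equiv> (\<lambda>n \<pi>. real (perm_height (2 ^ n) \<pi>))"
    and "\<alpha> \<equiv> log 2 (3 / 2)"
  shows "(\<forall>n\<ge>1. map_pmf (h n) (butterfly_pmf n) =
             map_pmf (\<lambda>x. 2 ^ x + 2 ^ (n - x) - 2) (binomial_pmf n (1 / 2)))
       \<and> weak_conv_m
           (\<lambda>n. distr (measure_pmf (butterfly_pmf n)) borel
                  (\<lambda>\<pi>. (log 2 (h n \<pi>) - real n / 2) / (sqrt (real n) / 2)))
           (distr std_normal_distribution borel (\<lambda>z. \<bar>z\<bar>))
       \<and> (\<forall>n\<ge>1. measure_pmf.expectation (butterfly_pmf n) (h n) = 2 * (3 / 2) ^ n - 2)
       \<and> (\<exists>\<epsilon> :: nat \<Rightarrow> real. \<epsilon> \<in> o(\<lambda>_. 1) \<and>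
            (\<forall>n\<ge>1. measure_pmf.expectation (butterfly_pmf n) (h n) =
                     2 * real (2 ^ n) powr \<alpha> * (1 + \<epsilon> n)))
       \<and> \<bar>\<alpha> - 0.58496\<bar> \<le> 0.000005"
proof (intro conjI allI impI)
  have h_eq: "map_pmf (h n) (butterfly_pmf n) =
      map_pmf (\<lambda>x. 2 ^ x + 2 ^ (n - x) - 2) (binomial_pmf n (1 / 2))" for n
    unfolding h_def by (rule map_pmf_height_butterfly)
  then show "map_pmf (h n) (butterfly_pmf n) =
      map_pmf (\<lambda>x. 2 ^ x + 2 ^ (n - x) - 2) (binomial_pmf n (1 / 2))" for n .
  \<comment> \<open>A general \<open>g\<close> lets any statistic of the height pass to the binomial
    model.\<close>
  have distr: "distr (measure_pmf (butterfly_pmf n)) borel (\<lambda>\<pi>. g (h n \<pi>)) =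
      distr (measure_pmf (binomial_pmf n (1 / 2))) borel (\<lambda>x. g (2 ^ x + 2 ^ (n - x) - 2))"
    for n and g :: "real \<Rightarrow> real"
    using arg_cong [OF h_eq [of n], of "\<lambda>p. distr (measure_pmf p) borel g"]
    by (simp add: map_pmf_rep_eq distr_distr comp_def)
  show "weak_conv_m
      (\<lambda>n. distr (measure_pmf (butterfly_pmf n)) borel
             (\<lambda>\<pi>. (log 2 (h n \<pi>) - real n / 2) / (sqrt (real n) / 2)))
      (distr std_normal_distribution borel (\<lambda>z. \<bar>z\<bar>))"
    unfolding distr [of n "\<lambda>y. (log 2 y - real n / 2) / (sqrt (real n) / 2)" for n]
    by (rule binomial_log2_height_CLT)
  have expect: "measure_pmf.expectation (butterfly_pmf n) (h n) = 2 * (3 / 2) ^ n - 2" for n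
    using arg_cong [OF h_eq [of n], of "\<lambda>p. measure_pmf.expectation p (\<lambda>x. x)"]
      expectation_binomial_height [of n] by simp
  then show "measure_pmf.expectation (butterfly_pmf n) (h n) = 2 * (3 / 2) ^ n - 2" for n .
  have powr: "real (2 ^ n) powr \<alpha> = (3 / 2) ^ n" for n
    using powr_powr_swap [of 2 "real n" \<alpha>] by (simp add: \<alpha>_def powr_realpow)
  show "\<exists>\<epsilon> :: nat \<Rightarrow> real. \<epsilon> \<in> o(\<lambda>_. 1) \<and>
      (\<forall>n\<ge>1. measure_pmf.expectation (butterfly_pmf n) (h n) =
               2 * real (2 ^ n) powr \<alpha> * (1 + \<epsilon> n))"
  proof (intro exI conjI allI impI)
    \<comment> \<open>The witness comes from factoring \<open>2 * (3 / 2) ^ n\<close> out of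
      \<open>2 * (3 / 2) ^ n - 2\<close>.\<close>
    show "(\<lambda>n. - ((2 / 3) ^ n :: real)) \<in> o(\<lambda>_. 1)" by real_asymp
    show "measure_pmf.expectation (butterfly_pmf n) (h n) =
        2 * real (2 ^ n) powr \<alpha> * (1 + - ((2 / 3) ^ n))" for n
      unfolding expect powr by (simp add: algebra_simps flip: power_mult_distrib)
  qed
  show "\<bar>\<alpha> - 0.58496\<bar> \<le> 0.000005"
    unfolding \<alpha>_def by (rule log_2_3_2_bounds)
qed

end
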